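(* Let $L$ be a non-empty countable relational language, let $F$ be a fragment of $L_{\omega_1\omega}$, and let $A\subseteq F$ be countable. Then the equivalence relation $$E_A=\{(x,y)\in X_L\times X_L: \text{for all }\varphi\in A,\ |\varphi^x|=|\varphi^y|\}$$ is a Borel subset of the product space $(X_L,t_F)\times(X_L,t_F)$.
   Context: $L=(R_i)_{i\in I}$ with $I$ non-empty countable and $R_i$ an $n_i$-ary relation symbol. $X_L=\prod_{i\in I}2^{(\mathbb{N}^{n_i})}$; each $x=(x_i)_{i\in I}\in X_L$ codes the $L$-structure $\mathcal{U}_x=(\mathbb{N},R_i^{\mathcal{U}_x})_{i\in I}$ where $R_i^{\mathcal{U}_x}(\bar s)$ iff $x_i(\bar s)=1$. $L_{\omega_1\omega}$ is the infinitary language built from atomic formulas $R_i(v_1,\dots,v_{n_i})$ by negation, first-order quantifiers, and finite or countable conjunctions/disjunctions (of sets of formulas whose variables come from a fixed finite set); $\Delta\varphi$ is the set of free variables of $\varphi$. A fragment $F$ of $L_{\omega_1\omega}$ is a set of formulas containing all atomic formulas and closed under subformulas, negation, quantifiers, and finite conjunctions and disjunctions. For $\varphi\in L_{\omega_1\omega}$ and $\bar s\in{}^{|\Delta\varphi|}\omega$, $Mod(\varphi,\bar s)=\{x\in X_L:\mathcal{U}_x\models\varphi[\bar s]\}$. $t_F$ is the topology on $X_L$ generated by $\{Mod(\varphi,\bar s):\varphi\in F,\ \bar s\in{}^{|\Delta\varphi|}\omega\}$. For $x\in X_L$, $\varphi^x=\{\bar s\in{}^{|\Delta\varphi|}\omega:\mathcal{U}_x\models\varphi[\bar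 s]\}$. *)

theory Defs
  imports
    "HOL-Analysis.Analysis"
    "HOL-Library.Countable_Set_Type"
    "HOL-Library.Equipollence"
begin

text \<open>
  A relational language is given by an index set \<open>I :: 'i set\<close> and an arity function
  \<open>n :: 'i \<Rightarrow> nat\<close>. Tuples are lists, and the variables are \<open>v\<^sub>0, v\<^sub>1, \<dots>\<close>, represented by
  their indices. There is no built-in equality symbol.
\<close>

datatype 'i fm =
    Atom 'i "nat list"
  | Neg "'i fm"
  | Exists nat "'i fm"
  | Forall nat "'i fm"
  | Conj "'i fm cset"
  | Disj "'i fm cset"

text \<open>All variables, free or bound.\<close>

primrec vars :: "'i fm \<Rightarrow> nat set" where
  "vars (Atom i vs) = set vs"
| "vars (Neg \<phi>) = vars \<phi>"
| "vars (Exists v \<phi>) = insert v (vars \<phi>)"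
| "vars (Forall v \<phi>) = insert v (vars \<phi>)"
| "vars (Conj \<Phi>) = \<Union> (rcset (cimage vars \<Phi>))"
| "vars (Disj \<Phi>) = \<Union> (rcset (cimage vars \<Phi>))"

text \<open>The set \<open>\<Delta>\<phi>\<close> of free variables.\<close>

primrec free_vars :: "'i fm \<Rightarrow> nat set" where
  "free_vars (Atom i vs) = set vs"
| "free_vars (Neg \<phi>) = free_vars \<phi>"
| "free_vars (Exists v \<phi>) = free_vars \<phi> - {v}"
| "free_vars (Forall v \<phi>) = free_vars \<phi> - {v}"
| "free_vars (Conj \<Phi>) = \<Union> (rcset (cimage free_vars \<Phi>))"
| "free_vars (Disj \<Phi>) = \<Union> (rcset (cimage free_vars \<Phi>))"

primrec subformulas :: "'i fm \<Rightarrow> 'i fm set" where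
  "subformulas (Atom i vs) = {Atom i vs}"
| "subformulas (Neg \<phi>) = insert (Neg \<phi>) (subformulas \<phi>)"
| "subformulas (Exists v \<phi>) = insert (Exists v \<phi>) (subformulas \<phi>)"
| "subformulas (Forall v \<phi>) = insert (Forall v \<phi>) (subformulas \<phi>)"
| "subformulas (Conj \<Phi>) = insert (Conj \<Phi>) (\<Union> (rcset (cimage subformulas \<Phi>)))"
| "subformulas (Disj \<Phi>) = insert (Disj \<Phi>) (\<Union> (rcset (cimage subformulas \<Phi>)))"

text \<open>
  \<open>L\<^bsub>\<omega>\<^sub>1\<omega>\<^esub>\<close>: the well-formed formulas. The members of a conjunction or disjunction must take
  their variables from a common finite set.
\<close>

inductive_set Lw1w :: "'i set \<Rightarrow> ('i \<Rightarrow> nat) \<Rightarrow> 'i fm set"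
  for I :: "'i set" and n :: "'i \<Rightarrow> nat" where
  Atom: "i \<in> I \<Longrightarrow> length vs = n i \<Longrightarrow> Atom i vs \<in> Lw1w I n"
| Neg: "\<phi> \<in> Lw1w I n \<Longrightarrow> Neg \<phi> \<in> Lw1w I n"
| Exists: "\<phi> \<in> Lw1w I n \<Longrightarrow> Exists v \<phi> \<in> Lw1w I n"
| Forall: "\<phi> \<in> Lw1w I n \<Longrightarrow> Forall v \<phi> \<in> Lw1w I n"
| Conj: "(\<And>\<phi>. \<phi> \<in> rcset \<Phi> \<Longrightarrow> \<phi> \<in> Lw1w I n) \<Longrightarrow> finite V \<Longrightarrow>
    (\<And>\<phi>. \<phi> \<in> rcset \<Phi> \<Longrightarrow> vars \<phi> \<subseteq> V) \<Longrightarrow> Conj \<Phi> \<in> Lw1w I n"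
| Disj: "(\<And>\<phi>. \<phi> \<in> rcset \<Phi> \<Longrightarrow> \<phi> \<in> Lw1w I n) \<Longrightarrow> finite V \<Longrightarrow>
    (\<And>\<phi>. \<phi> \<in> rcset \<Phi> \<Longrightarrow> vars \<phi> \<subseteq> V) \<Longrightarrow> Disj \<Phi> \<in> Lw1w I n"

text \<open>
  Closure is required for nonempty finite conjunctions and disjunctions only, so fragments that
  also contain the empty ones are covered but not forced.
\<close>

definition fragment :: "'i set \<Rightarrow> ('i \<Rightarrow> nat) \<Rightarrow> 'i fm set \<Rightarrow> bool" where
  "fragment I n F \<longleftrightarrow>
     F \<subseteq> Lw1w I n \<and>
     (\<forall>i\<in>I. \<forall>vs. length vs = n i \<longrightarrow> Atom i vs \<in> F) \<and>
     (\<forall>\<phi>\<in>F. subformulas \<phi> \<subseteq> F) \<and>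
     (\<forall>\<phi>\<in>F. Neg \<phi> \<in> F) \<and>
     (\<forall>\<phi>\<in>F. \<forall>v. Exists v \<phi> \<in> F \<and> Forall v \<phi> \<in> F) \<and>
     (\<forall>\<Phi>. finite (rcset \<Phi>) \<and> rcset \<Phi> \<noteq> {} \<and> rcset \<Phi> \<subseteq> F \<longrightarrow> Conj \<Phi> \<in> F \<and> Disj \<Phi> \<in> F)"

definition tuples :: "nat \<Rightarrow> nat list set" where
  "tuples k = {s. length s = k}"

text \<open>The space \<open>X\<^sub>L = \<Prod>\<^sub>i 2\<^bsup>(\<nat>\<^bsup>n i\<^esup>)\<^esup>\<close>, with \<open>bool\<close> for the two-element set.\<close>

definition X_space :: "'i set \<Rightarrow> ('i \<Rightarrow> nat) \<Rightarrow> ('i \<Rightarrow> nat list \<Rightarrow> bool) set" where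
  "X_space I n = (\<Pi>\<^sub>E i\<in>I. tuples (n i) \<rightarrow>\<^sub>E (UNIV :: bool set))"

text \<open>The relations of the coded structure \<open>\<U>\<^sub>x\<close>, whose domain is \<open>\<nat>\<close>.\<close>

definition structure_of :: "('i \<Rightarrow> nat) \<Rightarrow> ('i \<Rightarrow> nat list \<Rightarrow> bool) \<Rightarrow> 'i \<Rightarrow> nat list set" where
  "structure_of n x i = {s \<in> tuples (n i). x i s}"

text \<open>Satisfaction in the structure with domain \<open>UNIV\<close> and relations \<open>R\<close>.\<close>

primrec sat :: "('i \<Rightarrow> 'a list set) \<Rightarrow> 'i fm \<Rightarrow> (nat \<Rightarrow> 'a) \<Rightarrow> bool" where
  "sat R (Atom i vs) = (\<lambda>a. map a vs \<in> R i)"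
| "sat R (Neg \<phi>) = (\<lambda>a. \<not> sat R \<phi> a)"
| "sat R (Exists v \<phi>) = (\<lambda>a. \<exists>c. sat R \<phi> (a(v := c)))"
| "sat R (Forall v \<phi>) = (\<lambda>a. \<forall>c. sat R \<phi> (a(v := c)))"
| "sat R (Conj \<Phi>) = (\<lambda>a. \<forall>P \<in> rcset (cimage (sat R) \<Phi>). P a)"
| "sat R (Disj \<Phi>) = (\<lambda>a. \<exists>P \<in> rcset (cimage (sat R) \<Phi>). P a)"

text \<open>
  A tuple \<open>s\<close> of length \<open>card V\<close> is assigned to the finite set of variables \<open>V\<close> in increasing
  order; the values outside \<open>V\<close> are irrelevant.
\<close>

definition assign :: "nat set \<Rightarrow> 'a list \<Rightarrow> nat \<Rightarrow> 'a" where
  "assign V s v = s ! card {u \<in> V. u < v}"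

definition sat_tuple :: "('i \<Rightarrow> 'a list set) \<Rightarrow> 'i fm \<Rightarrow> 'a list \<Rightarrow> bool" where
  "sat_tuple R \<phi> s \<longleftrightarrow> sat R \<phi> (assign (free_vars \<phi>) s)"

definition Mod :: "'i set \<Rightarrow> ('i \<Rightarrow> nat) \<Rightarrow> 'i fm \<Rightarrow> nat list \<Rightarrow> ('i \<Rightarrow> nat list \<Rightarrow> bool) set" where
  "Mod I n \<phi> s = {x \<in> X_space I n. sat_tuple (structure_of n x) \<phi> s}"

definition t_top :: "'i set \<Rightarrow> ('i \<Rightarrow> nat) \<Rightarrow> 'i fm set \<Rightarrow> ('i \<Rightarrow> nat list \<Rightarrow> bool) topology" where
  "t_top I n F = topology_generated_by {Mod I n \<phi> s | \<phi> s. \<phi> \<in> F \<and> s \<in> tuples (card (free_vars \<phi>))}"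

text \<open>The set \<open>\<phi>\<^sup>x\<close>.\<close>

definition defined_set :: "('i \<Rightarrow> nat) \<Rightarrow> 'i fm \<Rightarrow> ('i \<Rightarrow> nat list \<Rightarrow> bool) \<Rightarrow> nat list set" where
  "defined_set n \<phi> x = {s \<in> tuples (card (free_vars \<phi>)). sat_tuple (structure_of n x) \<phi> s}"

text \<open>
  Cardinalities are compared by \<open>\<approx>\<close> because the sets may be infinite, where \<open>card\<close> is \<open>0\<close>.
\<close>

definition E_rel :: "'i set \<Rightarrow> ('i \<Rightarrow> nat) \<Rightarrow> 'i fm set \<Rightarrow>
    (('i \<Rightarrow> nat list \<Rightarrow> bool) \<times> ('i \<Rightarrow> nat list \<Rightarrow> bool)) set" where
  "E_rel I n A = {(x, y) \<in> X_space I n \<times> X_space I n.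
     \<forall>\<phi>\<in>A. defined_set n \<phi> x \<approx> defined_set n \<phi> y}"

lemma equiv_E_rel: "equiv (X_space I n) (E_rel I n A)"
proof (intro equivI refl_onI symI transI)
  show "E_rel I n A \<subseteq> X_space I n \<times> X_space I n"
    by (auto simp: E_rel_def)
next
  fix x assume "x \<in> X_space I n"
  then show "(x, x) \<in> E_rel I n A" by (simp add: E_rel_def)
next
  fix x y assume "(x, y) \<in> E_rel I n A"
  then show "(y, x) \<in> E_rel I n A" by (simp add: E_rel_def eqpoll_sym)
next
  fix x y z assume "(x, y) \<in> E_rel I n A" "(y, z) \<in> E_rel I n A"
  then show "(x, z) \<in> E_rel I n A"
    unfolding E_rel_def by (blast intro: eqpoll_trans)
qed

definition borel_sets_of :: "'a topology \<Rightarrow> 'a set set" where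
  "borel_sets_of T = sigma_sets (topspace T) {U. openin T U}"

text \<open>The topology \<open>t\<^sub>F\<close> lives on all of \<open>X\<^sub>L\<close>.\<close>

lemma topspace_t_top:
  assumes "I \<noteq> {}" and "fragment I n F"
  shows "topspace (t_top I n F) = X_space I n"
proof
  show "topspace (t_top I n F) \<subseteq> X_space I n"
    unfolding t_top_def topology_generated_by_topspace by (auto simp: Mod_def)
  obtain i where i: "i \<in> I" using assms(1) by blast
  define \<phi> where "\<phi> = Atom i (replicate (n i) 0)"
  define s where "s = replicate (card (free_vars \<phi>)) (0::nat)"
  have "\<phi> \<in> F" "Neg \<phi> \<in> F"
    using assms(2) i unfolding fragment_def \<phi>_def by auto
  moreover have "s \<in> tuples (card (free_vars \<phi>))" "s \<in> tuples (card (free_vars (Neg \<phi>)))"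
    by (auto simp: s_def tuples_def)
  ultimately have "Mod I n \<phi> s \<union> Mod I n (Neg \<phi>) s \<subseteq> topspace (t_top I n F)"
    unfolding t_top_def topology_generated_by_topspace by blast
  moreover have "X_space I n = Mod I n \<phi> s \<union> Mod I n (Neg \<phi>) s"
    by (auto simp: Mod_def sat_tuple_def)
  ultimately show "X_space I n \<subseteq> topspace (t_top I n F)" by simp
qed

end

theory Submission
  imports Defs
begin

text \<open>
  Two countable sets are equipollent iff, for every \<open>k\<close>, either both or neither have a subset with
  exactly \<open>k\<close> elements. That \<open>\<phi>\<^sup>x\<close> has such a subset is a \<open>t\<^sub>F\<close>-open condition on \<open>x\<close>: it is a union,
  over the sets \<open>B\<close> of \<open>k\<close> tuples, of the finite intersections \<open>\<Inter>s\<in>B. Mod(\<phi>, s)\<close>. Hence \<open>E\<^sub>A\<close> is a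
  countable intersection of sets \<open>(U \<times> U) \<union> (U\<^sup>c \<times> U\<^sup>c)\<close> with \<open>U\<close> open.
\<close>

text \<open>The sizes \<open>k\<close> realised by finite subsets are exactly those up to
  \<open>card S\<close> when \<open>S\<close> is finite, and all of them when \<open>S\<close> is
  infinite. They therefore determine the cardinality, since any two countably infinite sets are
  equipollent.\<close>

lemma countable_eqpoll_iff_card_subsets:
  assumes "countable S" "countable T"
  shows "S \<approx> T \<longleftrightarrow>
    (\<forall>k. (\<exists>B\<subseteq>S. finite B \<and> card B = k) \<longleftrightarrow> (\<exists>B\<subseteq>T. finite B \<and> card B = k))"
    (is "_ \<longleftrightarrow> (\<forall>k. ?P S k \<longleftrightarrow> ?Q T k)")
proof
  assume "S \<approx> T"
  then obtain f where f: "bij_betw f S T" unfolding eqpoll_def by blast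
  show "\<forall>k. ?P S k \<longleftrightarrow> ?Q T k"
  proof (intro allI iffI)
    fix k assume "?P S k"
    then obtain B where B: "B \<subseteq> S" "finite B" "card B = k" by blast
    then have "card (f ` B) = k" "f ` B \<subseteq> T"
      using f by (auto simp: bij_betw_def card_image inj_on_subset)
    with B show "?Q T k" by blast
  next
    fix k assume "?Q T k"
    then obtain B where B: "B \<subseteq> T" "finite B" "card B = k" by blast
    have g: "bij_betw (inv_into S f) T S" using f by (rule bij_betw_inv_into)
    have "card (inv_into S f ` B) = k" "inv_into S f ` B \<subseteq> S"
      using B g by (auto simp: bij_betw_def card_image inj_on_subset)
    with B show "?P S k" by blast
  qed
next
  assume eq: "\<forall>k. ?P S k \<longleftrightarrow> ?Q T k"
  have P_finite: "?P S k \<longleftrightarrow> k \<le> card S" if "finite S" for k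
    using that by (metis card_mono obtain_subset_with_card_n)
  have Q_finite: "?Q T k \<longleftrightarrow> k \<le> card T" if "finite T" for k
    using that by (metis card_mono obtain_subset_with_card_n)
  have P_infinite: "?P S k" if "infinite S" for k
    using infinite_arbitrarily_large[OF that] by blast
  have Q_infinite: "?Q T k" if "infinite T" for k
    using infinite_arbitrarily_large[OF that] by blast
  show "S \<approx> T"
  proof (cases "finite S")
    case True
    have fin: "finite T"
    proof (rule ccontr)
      assume "infinite T"
      \<comment> \<open>The contradiction comes from the size \<open>Suc (card S)\<close>, which
        occurs in \<open>T\<close> but not in \<open>S\<close>.\<close>
      from Q_infinite[OF this] eq P_finite[OF True] show False by (metis not_less_eq_eq order_refl)
    qed
    have "k \<le> card S \<longleftrightarrow> k \<le> card T" for k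
      using eq P_finite[OF True, of k] Q_finite[OF fin, of k] by metis
    \<comment> \<open>The instances \<open>k = card S\<close> and \<open>k = card T\<close> give the
      two inequalities.\<close>
    then have "card S = card T" by (metis order_antisym order_refl)
    with True fin show ?thesis by (simp add: eqpoll_iff_card)
  next
    case False
    have inf: "infinite T"
    proof
      assume "finite T"
      from Q_finite[OF this] eq P_infinite[OF False] show False by (metis not_less_eq_eq order_refl)
    qed
    obtain g where g: "bij_betw g S (UNIV :: nat set)"
      using countableE_infinite[OF assms(1) False] .
    obtain h where h: "bij_betw h T (UNIV :: nat set)"
      using countableE_infinite[OF assms(2) inf] .
    have "S \<approx> (UNIV :: nat set)" "T \<approx> (UNIV :: nat set)"
      using g h unfolding eqpoll_def by blast+
    then show ?thesis using eqpoll_trans eqpoll_sym by blast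
  qed
qed

lemma sigma_algebra_borel_sets_of: "sigma_algebra (topspace T) (borel_sets_of T)"
  unfolding borel_sets_of_def
  by (intro sigma_algebra_sigma_sets) (auto dest: openin_subset)

lemma openin_borel_sets_of: "openin T U \<Longrightarrow> U \<in> borel_sets_of T"
  by (auto simp: borel_sets_of_def)

lemma openin_defined_set_card_subset:
  assumes "I \<noteq> {}" "fragment I n F" "\<phi> \<in> F"
  shows "openin (t_top I n F)
    {x \<in> X_space I n. \<exists>B\<subseteq>defined_set n \<phi> x. finite B \<and> card B = k}"
proof -
  let ?B = "{B. B \<subseteq> tuples (card (free_vars \<phi>)) \<and> finite B \<and> card B = k}"
  have "openin (t_top I n F) (Mod I n \<phi> s)" if "s \<in> tuples (card (free_vars \<phi>))" for s
    unfolding t_top_def using that assms(3) by (intro topology_generated_by_Basis) blast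
  \<comment> \<open>For \<open>k = 0\<close> the only \<open>B\<close> is empty and the bare
    intersection would be \<open>UNIV\<close>, so each intersection is cut down to the
    space.\<close>
  then have "openin (t_top I n F) ((\<Inter>s\<in>B. Mod I n \<phi> s) \<inter> topspace (t_top I n F))"
    if "B \<in> ?B" for B
    using that by (intro openin_INT) auto
  then have "openin (t_top I n F) (\<Union>B\<in>?B. (\<Inter>s\<in>B. Mod I n \<phi> s) \<inter> X_space I n)"
    using topspace_t_top[OF assms(1,2)] by (intro openin_Union) auto
  moreover have "{x \<in> X_space I n. \<exists>B\<subseteq>defined_set n \<phi> x. finite B \<and> card B = k}
    = (\<Union>B\<in>?B. (\<Inter>s\<in>B. Mod I n \<phi> s) \<inter> X_space I n)"
    by (auto simp: defined_set_def Mod_def subset_iff)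
  ultimately show ?thesis by simp
qed

text \<open>The cylinders \<open>U \<times> topspace T\<close> and
  \<open>topspace T \<times> U\<close> are open in the product. Their intersection collects the
  pairs with both coordinates in \<open>U\<close>, and the complement of their union those with
  neither.\<close>

lemma borel_sets_of_open_agreement:
  assumes "openin T U"
  shows "{(x, y) \<in> topspace T \<times> topspace T. x \<in> U \<longleftrightarrow> y \<in> U}
    \<in> borel_sets_of (prod_topology T T)"
proof -
  interpret sigma_algebra "topspace (prod_topology T T)" "borel_sets_of (prod_topology T T)"
    by (rule sigma_algebra_borel_sets_of)
  have "U \<times> topspace T \<in> borel_sets_of (prod_topology T T)"
    "topspace T \<times> U \<in> borel_sets_of (prod_topology T T)"
    by (auto intro!: openin_borel_sets_of simp: openin_prod_Times_iff assms)
  then have "(U \<times> topspace T \<inter> topspace T \<times> U) \<union>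
      (topspace (prod_topology T T) - (U \<times> topspace T \<union> topspace T \<times> U))
      \<in> borel_sets_of (prod_topology T T)"
    by (intro Un Int Diff top)
  moreover have "(U \<times> topspace T \<inter> topspace T \<times> U) \<union>
      (topspace (prod_topology T T) - (U \<times> topspace T \<union> topspace T \<times> U))
    = {(x, y) \<in> topspace T \<times> topspace T. x \<in> U \<longleftrightarrow> y \<in> U}"
    using openin_subset[OF assms] by auto
  ultimately show ?thesis by simp
qed

theorem theorem1:
  fixes I :: "'i set" and n :: "'i \<Rightarrow> nat" and F A :: "'i fm set"
  assumes "I \<noteq> {}" and "countable I"
    and "fragment I n F"
    and "A \<subseteq> F" and "countable A"
  shows "E_rel I n A \<in> borel_sets_of (prod_topology (t_top I n F) (t_top I n F))"
proof -
  let ?X = "X_space I n" and ?T = "prod_topology (t_top I n F) (t_top I n F)"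
  define U where "U \<phi> k = {x \<in> ?X. \<exists>B\<subseteq>defined_set n \<phi> x. finite B \<and> card B = k}" for \<phi> k
  define G where "G \<phi> k = {(x, y) \<in> ?X \<times> ?X. x \<in> U \<phi> k \<longleftrightarrow> y \<in> U \<phi> k}" for \<phi> k
  note topX = topspace_t_top[OF assms(1,3)]
  interpret sigma_algebra "topspace ?T" "borel_sets_of ?T"
    by (rule sigma_algebra_borel_sets_of)
  have G: "G \<phi> k \<in> borel_sets_of ?T" if "\<phi> \<in> A" for \<phi> k
  proof -
    have "openin (t_top I n F) (U \<phi> k)"
      unfolding U_def using that assms(4)
      by (intro openin_defined_set_card_subset[OF assms(1,3)]) blast
    from borel_sets_of_open_agreement[OF this] show ?thesis
      unfolding G_def topX .
  qed
  \<comment> \<open>The defined sets consist of lists of naturals, hence are countable.\<close>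
  have U: "defined_set n \<phi> x \<approx> defined_set n \<phi> y \<longleftrightarrow> (\<forall>k. x \<in> U \<phi> k \<longleftrightarrow> y \<in> U \<phi> k)"
    if "x \<in> ?X" "y \<in> ?X" for \<phi> x y
    using that unfolding U_def
    by (subst countable_eqpoll_iff_card_subsets) simp_all
  \<comment> \<open>Restricting to \<open>topspace ?T\<close> keeps this valid for
    \<open>A = {}\<close>, where an intersection over \<open>A\<close> would be
    \<open>UNIV\<close>.\<close>
  have E: "E_rel I n A = {p \<in> topspace ?T. \<forall>\<phi>\<in>A. \<forall>k. p \<in> G \<phi> k}"
    unfolding E_rel_def G_def using U by (auto simp: topX)
  show ?thesis
  proof (cases "A = {}")
    case True
    then have "E_rel I n A = topspace ?T" unfolding E by simp
    then show ?thesis by (simp only: top)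
  next
    case False
    have "(\<Inter>k. G \<phi> k) \<in> borel_sets_of ?T" if "\<phi> \<in> A" for \<phi>
      using G[OF that] by (intro countable_INT) auto
    \<comment> \<open>Countability of \<open>A\<close> enters here: a sigma-algebra is closed under
      nonempty countable intersections.\<close>
    then have "(\<Inter>\<phi>\<in>A. \<Inter>k. G \<phi> k) \<in> borel_sets_of ?T"
      using assms(5) False by (intro countable_INT') auto
    moreover have "E_rel I n A = (\<Inter>\<phi>\<in>A. \<Inter>k. G \<phi> k)"
      using False unfolding E by (auto simp: G_def topX)
    ultimately show ?thesis by simp
  qed
qed

end
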